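(* Consider a network Cournot game with a system operator (NCGSO) on a market network $(A,B,c^-,c^+,H)$ with $H=I$ the identity matrix, with production cost functions $\Psi_i:\mathbb{R}_+^m\to\mathbb{R}_+$ ($i\in\mathcal N$) that are continuous, strictly increasing, convex, and satisfy $\Psi_i(0)=0$; inverse demand functions $\Phi_j:\mathbb{R}\to\mathbb{R}$ ($j\in\mathcal M$) that are continuous, strictly decreasing, concave, and satisfy $\Phi_j(\bar z_j)=0$ for some finite $\bar z_j>0$; and Walrasian welfare function $$\omega(x,z)=\sum_{j\in\mathcal M}\int_0^{z_j}\Phi_j(s)\,\mathrm{d}s-\sum_{i\in\mathcal N}\Psi_i(x_i).$$ If there is a constant $a>0$ such that $\Phi_j(0)=a$ for every $j\in\mathcal M$, then $$z=\operatorname{diag}(A'x)+By\ge0\quad\text{(entrywise)}$$ for every $x\in\mathbb{R}_+^{n\times m}$ and every $y\in\mathcal B_0(x)$.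
   Context: Market network. $\mathcal N=\{1,\dots,n\}$ is a nonempty finite set of producers, $\mathcal M=\{1,\dots,m\}$ a finite set of markets, $\mathcal L=\{1,\dots,l\}$ a finite set of links. Each link $k$ has a tail $\sigma_k\in\mathcal M$ and a head $\tau_k\in\mathcal M\setminus\{\sigma_k\}$ (parallel links are allowed). A market network is a tuple $(A,B,c^-,c^+,H)$ where: $A\in\{0,1\}^{n\times m}$ is the producer-market adjacency matrix ($A_{ij}=1$ iff producer $i$ can sell on market $j$; every producer can sell on at least one market); $B\in\{0,\pm1\}^{m\times l}$ is the market-link incidence matrix, $B_{jk}=1$ if $\tau_k=j$, $B_{jk}=-1$ if $\sigma_k=j$, $B_{jk}=0$ otherwise; $c^-,c^+\in\mathbb{R}_+^l$ are capacity vectors; $H\in\mathbb{R}^{l\times l}$ satisfies $BH=B$ (here $H=I$). Standing assumption: the market network is weakly connected, i.e. any two distinct markets are joined by a path of links ignoring orientation (equivalently $\mathrm{rank}(B)=m-1$). Game. An $x=(x_{ij})\in\mathbb{R}_+^{n\times m}$ collects the quantities sold by the producers, with rows $x_i$. The system operator (player $0$) has action set $\mathcal Y=\{y\in\mathbb{R}^l: -c^-\le Hy\le c^+\}$ (entrywise). Let $\operatorname{diag}(A'x)\in\mathbb{R}^m$ be the vector with entries $\sum_{i\in\mathcal N}A_{ij}x_{ij}$. The system operator's utility is $u_0(y,x)=\omega(x,\operatorname{diag}(A'x)+By)$, and its best response set to $x\in\mathbb{R}_+^{n\times m}$ is $\mathcal B_0(x)=\arg\max_{y\in\mathcal Y}u_0(y,x)$.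 (Producers' utilities play no role in the claim.) "Strictly increasing" for $\Psi_i$ means $\Psi_i(v)<\Psi_i(w)$ whenever $v\le w$ entrywise and $v\ne w$. *)

theory Defs
  imports "HOL-Analysis.Analysis"
begin

text \<open>
  Producers and markets are the elements of finite types \<open>'n\<close> and \<open>'m\<close> (both are nonempty in the
  model, since every producer can sell on some market). The set of links may be empty (this is
  forced when there is a single market), so links form a finite set \<open>L\<close>, and vectors and matrices
  with link indices are functions that are only evaluated on \<open>L\<close>.
\<close>

locale market_network =
  fixes A :: "real ^ 'm::finite ^ 'n::finite"
    and L :: "'l set"
    and tail head :: "'l \<Rightarrow> 'm"
    and B :: "'m \<Rightarrow> 'l \<Rightarrow> real"
    and cminus cplus :: "'l \<Rightarrow> real"
    and H :: "'l \<Rightarrow> 'l \<Rightarrow> real"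
  assumes A_entries: "A $ i $ j \<in> {0, 1}"
    and A_sells: "\<exists>j. A $ i $ j = 1"
    and finite_links: "finite L"
    and no_loops: "k \<in> L \<Longrightarrow> head k \<noteq> tail k"
    and B_incidence: "k \<in> L \<Longrightarrow> B j k = (if head k = j then 1 else if tail k = j then -1 else 0)"
    and cminus_nonneg: "k \<in> L \<Longrightarrow> 0 \<le> cminus k"
    and cplus_nonneg: "k \<in> L \<Longrightarrow> 0 \<le> cplus k"
    and B_H: "k \<in> L \<Longrightarrow> (\<Sum>k'\<in>L. B j k' * H k' k) = B j k"
    and weakly_connected:
      "j \<noteq> j' \<Longrightarrow> (j, j') \<in> ((\<lambda>k. (tail k, head k)) ` L \<union> (\<lambda>k. (head k, tail k)) ` L)\<^sup>*"

text \<open>The order on \<^typ>\<open>real ^ 'm\<close> is the entrywise one, so \<open>{0..}\<close> is the nonnegative orthant.\<close>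

definition production_cost :: "(real ^ 'm::finite \<Rightarrow> real) \<Rightarrow> bool" where
  "production_cost \<psi> \<longleftrightarrow>
     (\<forall>v\<in>{0..}. 0 \<le> \<psi> v) \<and>
     continuous_on {0..} \<psi> \<and>
     (\<forall>v\<in>{0..}. \<forall>w\<in>{0..}. v \<le> w \<and> v \<noteq> w \<longrightarrow> \<psi> v < \<psi> w) \<and>
     convex_on {0..} \<psi> \<and>
     \<psi> 0 = 0"

definition inverse_demand :: "(real \<Rightarrow> real) \<Rightarrow> bool" where
  "inverse_demand \<phi> \<longleftrightarrow>
     continuous_on UNIV \<phi> \<and>
     (\<forall>s t. s < t \<longrightarrow> \<phi> t < \<phi> s) \<and>
     concave_on UNIV \<phi> \<and>
     (\<exists>z>0. \<phi> z = 0)"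

locale ncgso = market_network A L tail head B cminus cplus H
  for A :: "real ^ 'm::finite ^ 'n::finite"
    and L :: "'l set"
    and tail head :: "'l \<Rightarrow> 'm"
    and B :: "'m \<Rightarrow> 'l \<Rightarrow> real"
    and cminus cplus :: "'l \<Rightarrow> real"
    and H :: "'l \<Rightarrow> 'l \<Rightarrow> real" +
  fixes \<Psi> :: "'n \<Rightarrow> real ^ 'm \<Rightarrow> real"
    and \<Phi> :: "'m \<Rightarrow> real \<Rightarrow> real"
  assumes cost: "production_cost (\<Psi> i)"
    and demand: "inverse_demand (\<Phi> j)"

text \<open>
  The entries \<open>z $ j\<close> may be negative, so the integral from \<open>0\<close> to \<open>z $ j\<close> has to be the
  oriented one.
\<close>

definition walrasian_welfare ::
  "('n::finite \<Rightarrow> real ^ 'm::finite \<Rightarrow> real) \<Rightarrow> ('m \<Rightarrow> real \<Rightarrow> real)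
    \<Rightarrow> real ^ 'm ^ 'n \<Rightarrow> real ^ 'm \<Rightarrow> real" where
  "walrasian_welfare \<Psi> \<Phi> x z =
     (\<Sum>j\<in>UNIV. LBINT s=0..z $ j. \<Phi> j s) - (\<Sum>i\<in>UNIV. \<Psi> i (x $ i))"

definition diag :: "real ^ 'm ^ 'm \<Rightarrow> real ^ 'm::finite" where
  "diag X = (\<chi> j. X $ j $ j)"

definition link_mult :: "'l set \<Rightarrow> ('m \<Rightarrow> 'l \<Rightarrow> real) \<Rightarrow> ('l \<Rightarrow> real) \<Rightarrow> real ^ 'm::finite" where
  "link_mult L B y = (\<chi> j. \<Sum>k\<in>L. B j k * y k)"

definition market_quantities ::
  "real ^ 'm::finite ^ 'n::finite \<Rightarrow> 'l set \<Rightarrow> ('m \<Rightarrow> 'l \<Rightarrow> real)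
    \<Rightarrow> real ^ 'm ^ 'n \<Rightarrow> ('l \<Rightarrow> real) \<Rightarrow> real ^ 'm" where
  "market_quantities A L B x y = diag (transpose A ** x) + link_mult L B y"

text \<open>Here \<open>L \<rightarrow>\<^sub>E UNIV\<close> plays the role of the space of real vectors indexed by \<open>L\<close>.\<close>

definition operator_actions ::
  "'l set \<Rightarrow> ('l \<Rightarrow> real) \<Rightarrow> ('l \<Rightarrow> real) \<Rightarrow> ('l \<Rightarrow> 'l \<Rightarrow> real) \<Rightarrow> ('l \<Rightarrow> real) set" where
  "operator_actions L cminus cplus H =
     {y \<in> L \<rightarrow>\<^sub>E UNIV. \<forall>k\<in>L. - cminus k \<le> (\<Sum>k'\<in>L. H k k' * y k') \<and>
                            (\<Sum>k'\<in>L. H k k' * y k') \<le> cplus k}"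

definition operator_utility ::
  "real ^ 'm::finite ^ 'n::finite \<Rightarrow> 'l set \<Rightarrow> ('m \<Rightarrow> 'l \<Rightarrow> real)
    \<Rightarrow> ('n \<Rightarrow> real ^ 'm \<Rightarrow> real) \<Rightarrow> ('m \<Rightarrow> real \<Rightarrow> real)
    \<Rightarrow> ('l \<Rightarrow> real) \<Rightarrow> real ^ 'm ^ 'n \<Rightarrow> real" where
  "operator_utility A L B \<Psi> \<Phi> y x = walrasian_welfare \<Psi> \<Phi> x (market_quantities A L B x y)"

definition operator_best_responses ::
  "real ^ 'm::finite ^ 'n::finite \<Rightarrow> 'l set \<Rightarrow> ('m \<Rightarrow> 'l \<Rightarrow> real)
    \<Rightarrow> ('l \<Rightarrow> real) \<Rightarrow> ('l \<Rightarrow> real) \<Rightarrow> ('l \<Rightarrow> 'l \<Rightarrow> real)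
    \<Rightarrow> ('n \<Rightarrow> real ^ 'm \<Rightarrow> real) \<Rightarrow> ('m \<Rightarrow> real \<Rightarrow> real)
    \<Rightarrow> real ^ 'm ^ 'n \<Rightarrow> ('l \<Rightarrow> real) set" where
  "operator_best_responses A L B cminus cplus H \<Psi> \<Phi> x =
     {y. is_arg_max (\<lambda>y. operator_utility A L B \<Psi> \<Phi> y x)
           (\<lambda>y. y \<in> operator_actions L cminus cplus H) y}"

end

theory Submission imports Defs begin

text \<open>
  Let \<open>S\<close> be the set of markets with a negative quantity. If \<open>S\<close> is nonempty, then, since
  production is nonnegative, the net flow out of \<open>S\<close> is positive, so some link carries a positive
  flow out of \<open>S\<close>. Its price at the market inside \<open>S\<close> exceeds \<open>a\<close>, its price at the market outside
  is at most \<open>a\<close>. But at a best response the flow on every link goes from the lower to the higher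
  price: shrinking a flow towards \<open>0\<close> is always feasible, because the capacity interval contains
  \<open>0\<close>, and would otherwise increase the welfare to first order.
\<close>

text \<open>The fundamental theorem of calculus gives a derivative within a closed interval.
  Extending it by 1 beyond \<open>c\<close> and \<open>t\<close> puts \<open>t\<close> in the
  interior, so the derivative is two-sided; \<open>t < c\<close> is allowed.\<close>

lemma interval_integral_has_real_derivative:
  fixes f :: "real \<Rightarrow> real"
  assumes "continuous_on UNIV f"
  shows "((\<lambda>u. LBINT s=ereal c..ereal u. f s) has_real_derivative f t) (at t)"
proof -
  let ?I = "{min c t - 1<..<max c t + 1}"
  have "((\<lambda>u. LBINT s=c..u. f s) has_vector_derivative f t)
      (at t within {min c t - 1..max c t + 1})"
    by (rule interval_integral_FTC2) (auto intro: continuous_on_subset[OF assms])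
  then have "((\<lambda>u. LBINT s=c..u. f s) has_vector_derivative f t) (at t within ?I)"
    by (rule has_vector_derivative_within_subset) auto
  moreover have "at t within ?I = at t"
    by (rule at_within_open) auto
  ultimately show ?thesis
    unfolding has_real_derivative_iff_has_vector_derivative by simp
qed

lemma operator_actions_identity:
  assumes "finite L" and "\<And>k k'. k \<in> L \<Longrightarrow> k' \<in> L \<Longrightarrow> H k k' = (if k = k' then 1 else 0)"
  shows "operator_actions L cminus cplus H =
    {y \<in> L \<rightarrow>\<^sub>E UNIV. \<forall>k\<in>L. - cminus k \<le> y k \<and> y k \<le> cplus k}"
proof -
  have "(\<Sum>k'\<in>L. H k k' * y k') = y k" if "k \<in> L" for k and y :: "'a \<Rightarrow> real"
  proof -
    have "(\<Sum>k'\<in>L. H k k' * y k') = (\<Sum>k'\<in>L. if k' = k then y k' else 0)"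
      using that by (intro sum.cong) (auto simp: assms(2))
    then show ?thesis using that assms(1) by simp
  qed
  then show ?thesis by (auto simp: operator_actions_def)
qed

lemma market_quantities_update:
  assumes "finite L" "k \<in> L"
  shows "market_quantities A L B x (y(k := y k + t)) $ j = market_quantities A L B x y $ j + B j k * t"
proof -
  have "(\<Sum>k'\<in>L. B j k' * (y(k := y k + t)) k')
      = (\<Sum>k'\<in>L. B j k' * y k' + (if k' = k then B j k * t else 0))"
    by (intro sum.cong) (auto simp: algebra_simps)
  also have "\<dots> = (\<Sum>k'\<in>L. B j k' * y k') + B j k * t"
    using assms by (simp add: sum.distrib)
  finally show ?thesis by (simp add: market_quantities_def link_mult_def)
qed

context market_network begin

text \<open>A column of \<open>B\<close> has just two nonzero entries, 1 at the head and -1 at the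
  tail. They are distinct entries because there are no loops.\<close>

lemma sum_incidence_column:
  fixes f :: "'m \<Rightarrow> real"
  assumes "k \<in> L"
  shows "(\<Sum>j\<in>UNIV. f j * B j k) = f (head k) - f (tail k)"
proof -
  have "(\<Sum>j\<in>UNIV. f j * B j k)
      = (\<Sum>j\<in>UNIV. (if j = head k then f j else 0) - (if j = tail k then f j else 0))"
    using no_loops[OF assms] by (intro sum.cong) (auto simp: B_incidence[OF assms])
  then show ?thesis by (simp add: sum_subtractf)
qed

text \<open>This is the net inflow into \<open>S\<close>: links with both ends in \<open>S\<close>
  cancel, so only links crossing the boundary of \<open>S\<close> count.\<close>

lemma sum_link_mult:
  "(\<Sum>j\<in>S. link_mult L B y $ j) = (\<Sum>k\<in>L. (indicator S (head k) - indicator S (tail k)) * y k)"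
proof -
  have "(\<Sum>j\<in>S. link_mult L B y $ j) = (\<Sum>j\<in>UNIV. indicator S j * (\<Sum>k\<in>L. B j k * y k))"
    by (intro sum.mono_neutral_cong_left) (auto simp: link_mult_def)
  also have "\<dots> = (\<Sum>j\<in>UNIV. \<Sum>k\<in>L. indicator S j * B j k * y k)"
    by (simp add: sum_distrib_left mult.assoc)
  also have "\<dots> = (\<Sum>k\<in>L. (\<Sum>j\<in>UNIV. indicator S j * B j k) * y k)"
    unfolding sum_distrib_right by (rule sum.swap)
  also have "\<dots> = (\<Sum>k\<in>L. (indicator S (head k) - indicator S (tail k)) * y k)"
    by (intro sum.cong refl) (simp only: sum_incidence_column)
  finally show ?thesis .
qed

lemma link_mult_le_market_quantities:
  assumes "\<And>i j. 0 \<le> x $ i $ j"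
  shows "link_mult L B y $ j \<le> market_quantities A L B x y $ j"
proof -
  have "0 \<le> A $ i $ j" for i
    using A_entries[of i j] by auto
  then have "0 \<le> diag (transpose A ** x) $ j"
    by (auto simp: diag_def matrix_matrix_mult_def transpose_def assms intro!: sum_nonneg)
  then show ?thesis by (simp add: market_quantities_def)
qed

end

context ncgso begin

lemma inverse_demand_continuous: "continuous_on UNIV (\<Phi> j)"
  using demand[of j] by (simp add: inverse_demand_def)

lemma inverse_demand_less: "s < t \<Longrightarrow> \<Phi> j t < \<Phi> j s"
  using demand[of j] by (simp add: inverse_demand_def)

text \<open>Extra flow on \<open>k\<close> moves quantity from the tail to the head, so its marginal
  welfare is the price difference. Production costs do not depend on \<open>y\<close>.\<close>

lemma operator_utility_has_derivative_along_link:
  assumes "k \<in> L"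
  shows "((\<lambda>e. operator_utility A L B \<Psi> \<Phi> (y(k := y k + e * d)) x) has_real_derivative
    d * (\<Phi> (head k) (market_quantities A L B x y $ head k)
       - \<Phi> (tail k) (market_quantities A L B x y $ tail k))) (at 0)"
proof -
  define z where "z = market_quantities A L B x y"
  have "((\<lambda>e. LBINT s=0..z $ j + B j k * (e * d). \<Phi> j s) has_real_derivative
      \<Phi> j (z $ j) * (B j k * d)) (at 0)" for j
  proof -
    have "((\<lambda>e. z $ j + B j k * (e * d)) has_real_derivative B j k * d) (at 0)"
      by (auto intro!: derivative_eq_intros)
    from DERIV_chain2[OF interval_integral_has_real_derivative[OF inverse_demand_continuous, of 0] this]
    show ?thesis by (simp add: zero_ereal_def)
  qed
  then have "((\<lambda>e. operator_utility A L B \<Psi> \<Phi> (y(k := y k + e * d)) x) has_real_derivative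
      (\<Sum>j\<in>UNIV. \<Phi> j (z $ j) * (B j k * d))) (at 0)"
    unfolding operator_utility_def walrasian_welfare_def
      market_quantities_update[OF finite_links assms] z_def
    by (auto intro!: derivative_eq_intros DERIV_sum)
  moreover have "(\<Sum>j\<in>UNIV. \<Phi> j (z $ j) * (B j k * d))
      = d * (\<Phi> (head k) (z $ head k) - \<Phi> (tail k) (z $ tail k))"
    unfolding sum_incidence_column[OF assms, of "\<lambda>j. \<Phi> j (z $ j)", symmetric]
    by (simp add: sum_distrib_left algebra_simps)
  ultimately show ?thesis by (simp add: z_def)
qed

lemma best_response_flow_along_price_gradient:
  assumes H: "\<And>k k'. k \<in> L \<Longrightarrow> k' \<in> L \<Longrightarrow> H k k' = (if k = k' then 1 else 0)"
    and y: "y \<in> operator_best_responses A L B cminus cplus H \<Psi> \<Phi> x"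
    and k: "k \<in> L"
  shows "0 \<le> y k * (\<Phi> (head k) (market_quantities A L B x y $ head k)
    - \<Phi> (tail k) (market_quantities A L B x y $ tail k))"
proof (rule ccontr)
  \<comment> \<open>Moving in direction \<open>- y k\<close> scales the flow on \<open>k\<close> by
    \<open>1 - e\<close>. If the claim fails, the utility has a positive derivative in this
    direction.\<close>
  let ?y = "\<lambda>e. y(k := y k + e * (- y k))"
  let ?u = "\<lambda>e. operator_utility A L B \<Psi> \<Phi> (?y e) x"
  assume "\<not> ?thesis"
  then have "\<exists>d>0. \<forall>h>0. h < d \<longrightarrow> ?u 0 < ?u (0 + h)"
    by (intro DERIV_pos_inc_right[OF operator_utility_has_derivative_along_link[OF k]]) simp
  then obtain d where d: "d > 0" "\<And>h. 0 < h \<Longrightarrow> h < d \<Longrightarrow> ?u 0 < ?u h"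
    by auto
  \<comment> \<open>Halving \<open>d\<close> gives \<open>e < d\<close>; the cap 1 makes the scaled
    flow a convex combination of \<open>y k\<close> and 0.\<close>
  define e where "e = min (d / 2) 1"
  have e: "0 < e" "e < d" "e \<le> 1"
    using d(1) by (auto simp: e_def)
  have feasible: "y \<in> L \<rightarrow>\<^sub>E UNIV" "\<And>k. k \<in> L \<Longrightarrow> - cminus k \<le> y k \<and> y k \<le> cplus k"
    using y by (auto simp: operator_best_responses_def is_arg_max_def
        operator_actions_identity[where H = H, OF finite_links H])
  have "(1 - e) *\<^sub>R y k + e *\<^sub>R 0 \<in> {- cminus k..cplus k}"
    using feasible(2)[OF k] cminus_nonneg[OF k] cplus_nonneg[OF k] e
    by (intro convexD_alt) auto
  then have "?y e \<in> operator_actions L cminus cplus H"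
    using feasible k
    by (auto simp: operator_actions_identity[where H = H, OF finite_links H] PiE_iff extensional_def
        algebra_simps)
  moreover have "?u 0 < ?u e"
    by (rule d(2)[OF e(1,2)])
  ultimately show False
    using y by (auto simp: operator_best_responses_def is_arg_max_def)
qed

end

theorem theorem4:
  fixes A :: "real ^ 'm::finite ^ 'n::finite"
    and L :: "'l set"
    and tail head :: "'l \<Rightarrow> 'm"
    and B :: "'m \<Rightarrow> 'l \<Rightarrow> real"
    and cminus cplus :: "'l \<Rightarrow> real"
    and H :: "'l \<Rightarrow> 'l \<Rightarrow> real"
    and \<Psi> :: "'n \<Rightarrow> real ^ 'm \<Rightarrow> real"
    and \<Phi> :: "'m \<Rightarrow> real \<Rightarrow> real"
    and a :: real
    and x :: "real ^ 'm ^ 'n"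
    and y :: "'l \<Rightarrow> real"
  assumes "ncgso A L tail head B cminus cplus H \<Psi> \<Phi>"
    and "\<And>k k'. k \<in> L \<Longrightarrow> k' \<in> L \<Longrightarrow> H k k' = (if k = k' then 1 else 0)"
    and "a > 0"
    and "\<And>j. \<Phi> j 0 = a"
    and "\<And>i j. 0 \<le> x $ i $ j"
    and "y \<in> operator_best_responses A L B cminus cplus H \<Psi> \<Phi> x"
  shows "0 \<le> market_quantities A L B x y $ j"
proof (rule ccontr)
  interpret ncgso A L tail head B cminus cplus H \<Psi> \<Phi> by fact
  define z where "z = market_quantities A L B x y"
  define S where "S = {j. z $ j < 0}"
  \<comment> \<open>The common value \<open>a\<close> of all prices at quantity 0 is the threshold
    that makes different markets comparable.\<close>
  have above: "a < \<Phi> j (z $ j)" if "j \<in> S" for j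
    using inverse_demand_less[of "z $ j" 0 j] that by (simp add: S_def assms(4))
  have below: "\<Phi> j (z $ j) \<le> a" if "j \<notin> S" for j
    using inverse_demand_less[of 0 "z $ j" j] that
    by (cases "z $ j = 0") (auto simp: S_def assms(4))
  assume "\<not> ?thesis"
  then have "j \<in> S" by (simp add: S_def z_def)
  then have "(\<Sum>j\<in>S. z $ j) < (\<Sum>j\<in>S. 0)"
    by (intro sum_strict_mono) (auto simp: S_def)
  moreover have "(\<Sum>j\<in>S. link_mult L B y $ j) \<le> (\<Sum>j\<in>S. z $ j)"
    unfolding z_def by (intro sum_mono link_mult_le_market_quantities assms(5))
  ultimately have "(\<Sum>k\<in>L. (indicator S (head k) - indicator S (tail k)) * y k) < 0"
    by (simp add: sum_link_mult)
  \<comment> \<open>A negative sum has a negative term.\<close>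
  then obtain k where k: "k \<in> L" "(indicator S (head k) - indicator S (tail k)) * y k < 0"
    by (meson not_less sum_nonneg)
  have flow: "0 \<le> y k * (\<Phi> (head k) (z $ head k) - \<Phi> (tail k) (z $ tail k))"
    unfolding z_def by (rule best_response_flow_along_price_gradient[OF assms(2) assms(6) k(1)])
  \<comment> \<open>The coefficient vanishes unless exactly one end of \<open>k\<close> lies in
    \<open>S\<close>. In both cases the flow leaves \<open>S\<close>, in the first one against the
    orientation of \<open>k\<close>.\<close>
  consider "head k \<in> S" "tail k \<notin> S" "y k < 0" | "head k \<notin> S" "tail k \<in> S" "y k > 0"
    using k(2) by (cases "head k \<in> S"; cases "tail k \<in> S") auto
  then show False
  proof cases
    case 1
    then show False
      using above[of "head k"] below[of "tail k"] flow by (simp add: zero_le_mult_iff)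
  next
    case 2
    then show False
      using above[of "tail k"] below[of "head k"] flow by (simp add: zero_le_mult_iff)
  qed
qed

end
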